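(* Assume $c(t)\ge 0$ for all $t\ge 0$ and $$\sup_{t\ge\rho}\int_{\tau(t)}^{t}|c(\zeta)|\,d\zeta\le \frac32 .$$ Then every oscillatory solution of $x'(t)+c(t)x(\tau(t))=0$ is bounded. If moreover the inequality is strict, i.e. $\sup_{t\ge\rho}\int_{\tau(t)}^{t}|c(\zeta)|\,d\zeta<\frac32$, then every oscillatory solution tends to zero as $t\to\infty$.
   Context: Consider the equation $x'(t)+c(t)x(\tau(t))=0$, $t\ge 0$. Standing assumptions: $c:[0,\infty)\to\mathbb R$ is Lebesgue measurable and locally integrable ($\int_0^t|c(u)|du<\infty$ for all $t\ge0$); $\tau:[0,\infty)\to\mathbb R$ is Lebesgue measurable, $\tau(t)\le t$ for all $t\ge 0$, and $\lim_{t\to\infty}\tau(t)=\infty$. For $t\ge0$ put $\tau_{\min}(t):=\inf_{v\ge t}\tau(v)$. Fix $a\ge 0$ with $\tau_{\min}(a)>0$ (such $a$ exists), and fix a number $\rho>\inf\{t>0:\tau_{\min}(t)>a\}$. A solution of the equation is a function $x:[\tau_{\min}(t_0),\infty)\to\mathbb R$, for some $t_0\in[\rho,\infty)$, which is absolutely continuous on $[\tau_{\min}(t_0),\infty)$ (i.e. on each compact subinterval) and satisfies the equation for almost every $t\in[t_0,\infty)$. A function is called oscillatory if it has arbitrarily large zeros. *)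

theory Defs
  imports "HOL-Analysis.Analysis"
begin

text \<open>All functions on half-lines are represented by total functions on the reals; only their
  values on the half-line are ever constrained or used.\<close>

text \<open>The infimum is taken in the extended reals, since a delay function may be unbounded below
  on a bounded interval.\<close>

definition tau_min :: "(real \<Rightarrow> real) \<Rightarrow> real \<Rightarrow> ereal" where
  "tau_min \<tau> t = (INF v\<in>{t..}. ereal (\<tau> v))"

definition sol_domain :: "(real \<Rightarrow> real) \<Rightarrow> real \<Rightarrow> real set" where
  "sol_domain \<tau> t0 = {s. tau_min \<tau> t0 \<le> ereal s}"

text \<open>Absolute continuity of a function on a compact interval (the library's
  \<open>absolutely_continuous\<close> is about measures). A pair in \<open>D\<close> stands for the open interval
  between its components; pairs with equal components contribute nothing.\<close>

definition abs_cont_interval :: "real \<Rightarrow> real \<Rightarrow> (real \<Rightarrow> real) \<Rightarrow> bool" where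
  "abs_cont_interval p q f \<longleftrightarrow>
     (\<forall>\<epsilon>>0. \<exists>\<delta>>0. \<forall>D :: (real \<times> real) set.
        finite D \<and> (\<forall>(u, v)\<in>D. p \<le> u \<and> u \<le> v \<and> v \<le> q) \<and>
        disjoint_family_on (\<lambda>(u, v). {u<..<v}) D \<and>
        (\<Sum>(u, v)\<in>D. v - u) < \<delta>
        \<longrightarrow> (\<Sum>(u, v)\<in>D. \<bar>f v - f u\<bar>) < \<epsilon>)"

definition loc_abs_cont_on :: "real set \<Rightarrow> (real \<Rightarrow> real) \<Rightarrow> bool" where
  "loc_abs_cont_on S f \<longleftrightarrow> (\<forall>p q. p \<le> q \<and> {p..q} \<subseteq> S \<longrightarrow> abs_cont_interval p q f)"

definition is_solution ::
  "(real \<Rightarrow> real) \<Rightarrow> (real \<Rightarrow> real) \<Rightarrow> real \<Rightarrow> (real \<Rightarrow> real) \<Rightarrow> bool" where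
  "is_solution c \<tau> t0 x \<longleftrightarrow>
     loc_abs_cont_on (sol_domain \<tau> t0) x \<and>
     (AE t\<in>{t0..} in lebesgue. x differentiable (at t) \<and> deriv x t + c t * x (\<tau> t) = 0)"

definition oscillatory_on :: "real set \<Rightarrow> (real \<Rightarrow> real) \<Rightarrow> bool" where
  "oscillatory_on S x \<longleftrightarrow> (\<forall>T. \<exists>t\<in>S. t \<ge> T \<and> x t = 0)"

text \<open>The supremum is again taken in the extended reals, so that it exists without a boundedness
  assumption.\<close>

definition sup_delay_integral :: "(real \<Rightarrow> real) \<Rightarrow> (real \<Rightarrow> real) \<Rightarrow> real \<Rightarrow> ereal" where
  "sup_delay_integral c \<tau> \<rho> =
     (SUP t\<in>{\<rho>..}. ereal (LINT \<zeta>:{\<tau> t..t}|lebesgue. \<bar>c \<zeta>\<bar>))"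

end

theory Submission
  imports Defs
begin

text \<open>
  Let \<open>\<xi>\<close> be the last zero of \<open>x\<close> before \<open>s\<close>, say with \<open>x \<ge> 0\<close> on \<open>[\<xi>, s]\<close>, and let \<open>B\<close> bound \<open>\<bar>x\<bar>\<close>
  on the past of \<open>\<xi>\<close>. For \<open>r \<in> [\<xi>, s]\<close> the value \<open>- x (\<tau> r)\<close> is nonpositive if \<open>\<tau> r \<ge> \<xi>\<close>;
  otherwise it is at most \<open>B\<close>, and, by integrating the equation from \<open>\<tau> r\<close> to \<open>\<xi>\<close>, at most
  \<open>B \<integral>\<^bsub>\<tau> r\<^esub>\<^bsup>\<xi>\<^esup> c \<le> B (K - w)\<close> with \<open>w = \<integral>\<^bsub>\<xi>\<^esub>\<^bsup>r\<^esup> c\<close>, where \<open>K\<close> bounds the delay integrals.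
  Substituting \<open>w\<close> for \<open>r\<close> gives \<open>x s \<le> B \<integral>\<^sub>0\<^bsup>K\<^esup> min 1 (K - w) dw = B (K - 1/2)\<close>.
  If \<open>K \<le> 3/2\<close>, then \<open>\<bar>x s\<bar> \<le> B\<close>, so \<open>\<bar>x\<bar>\<close> cannot reach a new strict maximum at \<open>s\<close>;
  if \<open>K < 3/2\<close>, then the tails of \<open>x\<close> are contracted by the factor \<open>K - 1/2 < 1\<close>.
\<close>

section \<open>Absolutely continuous functions and the gauge integral\<close>

lemma abs_cont_interval_imp_continuous_on:
  assumes "abs_cont_interval p q f"
  shows "continuous_on {p..q} f"
  unfolding continuous_on_iff
proof (intro ballI allI impI)
  fix t \<epsilon> :: real
  assume t: "t \<in> {p..q}" and "0 < \<epsilon>"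
  then obtain \<delta> where "0 < \<delta>" and \<delta>:
    "\<forall>D :: (real \<times> real) set. finite D \<and>
        (\<forall>(u, v)\<in>D. p \<le> u \<and> u \<le> v \<and> v \<le> q) \<and> disjoint_family_on (\<lambda>(u, v). {u<..<v}) D \<and>
        (\<Sum>(u, v)\<in>D. v - u) < \<delta> \<longrightarrow> (\<Sum>(u, v)\<in>D. \<bar>f v - f u\<bar>) < \<epsilon>"
    using assms unfolding abs_cont_interval_def by meson
  show "\<exists>d>0. \<forall>s\<in>{p..q}. dist s t < d \<longrightarrow> dist (f s) (f t) < \<epsilon>"
  proof (intro exI[of _ \<delta>] conjI ballI impI)
    fix s assume s: "s \<in> {p..q}" "dist s t < \<delta>"
    have "(\<Sum>(u, v)\<in>{(min s t, max s t)}. \<bar>f v - f u\<bar>) < \<epsilon>"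
      by (rule \<delta>[rule_format]) (use s t in \<open>auto simp: disjoint_family_on_def dist_real_def\<close>)
    then show "dist (f s) (f t) < \<epsilon>"
      by (auto simp: dist_real_def min_def max_def split: if_splits)
  qed fact
qed

text \<open>This is the point where absolute continuity is needed: in the fundamental theorem of calculus,
  the null set of tags without a derivative has to contribute arbitrarily little.\<close>

lemma tagged_division_sum_over_negligible_tags:
  assumes ac: "abs_cont_interval p q f" and "negligible N" and "0 < e"
  shows "\<exists>\<gamma>. gauge \<gamma> \<and> (\<forall>\<D>. \<D> tagged_division_of {p..q} \<and> \<gamma> fine \<D> \<longrightarrow>
       (\<Sum>(t, K)\<in>{z \<in> \<D>. fst z \<in> N}. \<bar>f (Sup K) - f (Inf K)\<bar>) < e)"
proof -
  obtain \<delta> where "0 < \<delta>" and \<delta>: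
    "\<forall>D :: (real \<times> real) set. finite D \<and>
        (\<forall>(u, v)\<in>D. p \<le> u \<and> u \<le> v \<and> v \<le> q) \<and> disjoint_family_on (\<lambda>(u, v). {u<..<v}) D \<and>
        (\<Sum>(u, v)\<in>D. v - u) < \<delta> \<longrightarrow> (\<Sum>(u, v)\<in>D. \<bar>f v - f u\<bar>) < e"
    using ac \<open>0 < e\<close> unfolding abs_cont_interval_def by meson
  \<comment> \<open>Since \<open>N\<close> is null, an open superset with small excess over
    \<open>N\<close> itself has measure below \<open>\<delta>\<close>.\<close>
  obtain W where W: "open W" "N \<subseteq> W" and "W - N \<in> lmeasurable"
      and "emeasure lebesgue (W - N) < ennreal \<delta>"
    using sets_lebesgue_outer_open[OF negligible_imp_sets[OF \<open>negligible N\<close>] \<open>0 < \<delta>\<close>] by metis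
  moreover from this have "measure lebesgue (W - N) < \<delta>"
    by (simp add: emeasure_eq_measure2 ennreal_less_iff)
  moreover have "W = (W - N) \<union> N" using W by auto
  ultimately have W': "W \<in> lmeasurable" "measure lebesgue W < \<delta>"
    using \<open>negligible N\<close>
    by (metis fmeasurable.Un negligible_imp_measurable,
        metis W(1) borel_open measure_Diff_null_set negligible_iff_null_sets sets_completionI_sets sets_lborel)
  \<comment> \<open>A tag in \<open>N\<close> forces its whole interval into \<open>W\<close>, so
    the total length of such intervals stays below \<open>\<delta>\<close>.\<close>
  define \<gamma> where "\<gamma> t = (if t \<in> W then W else UNIV)" for t
  show ?thesis
  proof (intro exI[of _ \<gamma>] conjI allI impI)
    show "gauge \<gamma>" using W by (auto simp: gauge_def \<gamma>_def)
    fix \<D> assume "\<D> tagged_division_of {p..q} \<and> \<gamma> fine \<D>"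
    then have \<D>: "\<D> tagged_division_of {p..q}" and fine: "\<gamma> fine \<D>" by auto
    define E where "E = {z \<in> \<D>. fst z \<in> N}"
    \<comment> \<open>On nondegenerate intervals the open interiors are nonempty, so disjointness
      makes \<open>j\<close> injective. The omitted terms are zero.\<close>
    define E' where "E' = {z \<in> E. Inf (snd z) < Sup (snd z)}"
    define j :: "real \<times> real set \<Rightarrow> real \<times> real" where "j z = (Inf (snd z), Sup (snd z))" for z
    have fin: "finite E" "finite E'"
      using tagged_division_ofD(1)[OF \<D>] by (auto simp: E_def E'_def)
    have E: "\<exists>u v. K = {u..v} \<and> u \<le> v \<and> Inf K = u \<and> Sup K = v \<and> p \<le> u \<and> v \<le> q \<and> {u..v} \<subseteq> W"
      if tK: "(t, K) \<in> E" for t K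
    proof -
      have "(t, K) \<in> \<D>" "t \<in> N" using tK by (auto simp: E_def)
      obtain u v where K: "K = {u..v}"
        using tagged_division_ofD(4)[OF \<D> \<open>(t, K) \<in> \<D>\<close>] by (auto simp: box_real)
      have "t \<in> K" "K \<subseteq> {p..q}"
        using tagged_division_ofD(2,3)[OF \<D> \<open>(t, K) \<in> \<D>\<close>] by auto
      then have "u \<le> v" "p \<le> u" "v \<le> q" by (auto simp: K)
      moreover have "\<gamma> t = W" using \<open>t \<in> N\<close> W(2) by (auto simp: \<gamma>_def)
      then have "K \<subseteq> W"
        using fineD[OF fine \<open>(t, K) \<in> \<D>\<close>] by simp
      ultimately show ?thesis by (intro exI[of _ u] exI[of _ v]) (simp add: K)
    qed
    have disj: "{Inf K<..<Sup K} \<inter> {Inf K'<..<Sup K'} = {}"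
      if tK: "(t, K) \<in> E" "(t', K') \<in> E" "(t, K) \<noteq> (t', K')" for t K t' K'
    proof -
      have "interior K \<inter> interior K' = {}"
        by (rule tagged_division_ofD(5)[OF \<D> _ _ tK(3)]) (use tK in \<open>auto simp: E_def\<close>)
      moreover obtain u v u' v' where "K = {u..v}" "u \<le> v" "K' = {u'..v'}" "u' \<le> v'"
        using E tK by blast
      ultimately show ?thesis by simp
    qed
    have inj: "inj_on j E'"
    proof (rule inj_onI, clarify)
      fix t K t' K' assume *: "(t, K) \<in> E'" "(t', K') \<in> E'" "j (t, K) = j (t', K')"
      show "t = t' \<and> K = K'"
      proof (rule ccontr)
        assume "\<not> ?thesis"
        then have "{Inf K<..<Sup K} \<inter> {Inf K'<..<Sup K'} = {}"
          using disj * by (auto simp: E'_def)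
        with * show False by (auto simp: j_def E'_def)
      qed
    qed
    have pairs: "p \<le> u \<and> u \<le> v \<and> v \<le> q \<and> {u<..<v} \<subseteq> W" if uv: "(u, v) \<in> j ` E'" for u v
    proof -
      obtain t K where "(t, K) \<in> E" "u = Inf K" "v = Sup K"
        using uv by (auto simp: j_def E'_def)
      then obtain r s where "K = {r..s}" "r \<le> s" "p \<le> r" "s \<le> q" "{r..s} \<subseteq> W"
        using E by blast
      then show ?thesis using \<open>u = Inf K\<close> \<open>v = Sup K\<close>
        by (auto simp: subset_iff)
    qed
    have disj': "disjoint_family_on (\<lambda>(u, v). {u<..<v}) (j ` E')"
      unfolding disjoint_family_on_def
    proof (intro ballI impI)
      fix y z assume yz: "y \<in> j ` E'" "z \<in> j ` E'" "y \<noteq> z"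
      then obtain t K t' K' where "(t, K) \<in> E'" "(t', K') \<in> E'" "y = j (t, K)" "z = j (t', K')"
        by auto
      with yz(3) disj[of t K t' K'] show "(case y of (u, v) \<Rightarrow> {u<..<v}) \<inter> (case z of (u, v) \<Rightarrow> {u<..<v}) = {}"
        by (auto simp: j_def E'_def)
    qed
    have "(\<Sum>(u, v)\<in>j ` E'. v - u) = (\<Sum>y\<in>j ` E'. measure lebesgue (case y of (u, v) \<Rightarrow> {u<..<v}))"
      by (rule sum.cong) (use pairs in auto)
    also have "\<dots> = measure lebesgue (\<Union>y\<in>j ` E'. case y of (u, v) \<Rightarrow> {u<..<v})"
      by (rule measure_UNION'[symmetric])
        (use fin disj' in \<open>auto simp: pairwise_def disjnt_def disjoint_family_on_def\<close>)
    also have "\<dots> \<le> measure lebesgue W"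
    proof (rule measure_mono_fmeasurable)
      show "(\<Union>y\<in>j ` E'. case y of (u, v) \<Rightarrow> {u<..<v}) \<subseteq> W"
      proof (rule UN_least)
        fix y assume "y \<in> j ` E'"
        then show "(case y of (u, v) \<Rightarrow> {u<..<v}) \<subseteq> W" using pairs by (cases y) auto
      qed
      show "(\<Union>y\<in>j ` E'. case y of (u, v) \<Rightarrow> {u<..<v}) \<in> sets lebesgue"
        using fin by (intro sets.finite_UN) auto
    qed (rule W')
    finally have "(\<Sum>(u, v)\<in>j ` E'. v - u) < \<delta>" using W' by simp
    moreover have "\<forall>(u, v)\<in>j ` E'. p \<le> u \<and> u \<le> v \<and> v \<le> q"
    proof
      fix y assume "y \<in> j ` E'"
      then show "case y of (u, v) \<Rightarrow> p \<le> u \<and> u \<le> v \<and> v \<le> q" using pairs by (cases y) auto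
    qed
    ultimately have "(\<Sum>(u, v)\<in>j ` E'. \<bar>f v - f u\<bar>) < e"
      by (intro \<delta>[THEN spec, THEN mp] conjI disj') (use fin in simp_all)
    also have "(\<Sum>(u, v)\<in>j ` E'. \<bar>f v - f u\<bar>) = (\<Sum>(t, K)\<in>E'. \<bar>f (Sup K) - f (Inf K)\<bar>)"
      by (subst sum.reindex[OF inj]) (simp add: j_def case_prod_unfold o_def)
    also have "\<dots> = (\<Sum>(t, K)\<in>E. \<bar>f (Sup K) - f (Inf K)\<bar>)"
    proof (rule sum.mono_neutral_left)
      show "\<forall>z\<in>E - E'. (case z of (t, K) \<Rightarrow> \<bar>f (Sup K) - f (Inf K)\<bar>) = 0"
        using E by (fastforce simp: E'_def)
    qed (use fin in \<open>auto simp: E'_def\<close>)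
    finally show "(\<Sum>(t, K)\<in>{z \<in> \<D>. fst z \<in> N}. \<bar>f (Sup K) - f (Inf K)\<bar>) < e"
      by (simp add: E_def)
  qed
qed

text \<open>At tags outside \<open>N\<close>, differentiability makes the error at most
  \<open>d\<close> times the length of the interval; the tags in \<open>N\<close> contribute less
  than \<open>d\<close> in total by the preceding lemma.\<close>

lemma abs_cont_has_integral_derivative:
  assumes "p \<le> q" and ac: "abs_cont_interval p q f" and N: "negligible N"
    and der: "\<And>t. t \<in> {p..q} - N \<Longrightarrow> (f has_real_derivative g t) (at t within {p..q})"
  shows "(g has_integral f q - f p) {p..q}"
proof -
  \<comment> \<open>With value 0 on \<open>N\<close>, the terms of the Riemann sum at tags in
    \<open>N\<close> vanish, leaving only increments of \<open>f\<close>. Changing back to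
    \<open>g\<close> on a null set is harmless.\<close>
  define g' where "g' t = (if t \<in> N then 0 else g t)" for t
  have "(g' has_integral f q - f p) {p..q}"
    unfolding has_integral_real
  proof (intro allI impI)
    fix e :: real assume "0 < e"
    \<comment> \<open>The length \<open>q - p\<close> accounts for the regular tags, the added 1 for
      the tags in \<open>N\<close>.\<close>
    define d where "d = e / (q - p + 1)"
    have "0 < d" using \<open>0 < e\<close> \<open>p \<le> q\<close> by (simp add: d_def)
    have "d * (q - p + 1) = e" using \<open>p \<le> q\<close> by (simp add: d_def)
    then have "d * (q - p) + d = e" by (simp add: algebra_simps)
    obtain \<gamma>N where \<gamma>N: "gauge \<gamma>N" "\<forall>\<D>. \<D> tagged_division_of {p..q} \<and> \<gamma>N fine \<D> \<longrightarrow>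
       (\<Sum>(t, K)\<in>{z \<in> \<D>. fst z \<in> N}. \<bar>f (Sup K) - f (Inf K)\<bar>) < d"
      using tagged_division_sum_over_negligible_tags[OF ac N \<open>0 < d\<close>] by meson
    \<comment> \<open>Where \<open>t\<close> is exceptional, 1 is a default radius, so that
      \<open>r\<close> becomes a total function.\<close>
    have "\<exists>r>0. t \<in> {p..q} - N \<longrightarrow> (\<forall>y\<in>{p..q}. \<bar>y - t\<bar> < r \<longrightarrow> \<bar>f y - f t - g t * (y - t)\<bar> \<le> d * \<bar>y - t\<bar>)" for t
    proof (cases "t \<in> {p..q} - N")
      case True
      then show ?thesis
        using der[OF True] \<open>0 < d\<close>
        unfolding has_field_derivative_def has_derivative_within_alt by auto
    qed (auto intro: exI[of _ 1])
    then obtain r where r: "\<And>t. 0 < r t" "\<And>t y. t \<in> {p..q} - N \<Longrightarrow> y \<in> {p..q} \<Longrightarrow> \<bar>y - t\<bar> < r t \<Longrightarrow>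
        \<bar>f y - f t - g t * (y - t)\<bar> \<le> d * \<bar>y - t\<bar>"
      by metis
    show "\<exists>\<gamma>. gauge \<gamma> \<and> (\<forall>\<D>. \<D> tagged_division_of {p..q} \<and> \<gamma> fine \<D> \<longrightarrow>
        norm ((\<Sum>(t, K)\<in>\<D>. measure lborel K *\<^sub>R g' t) - (f q - f p)) < e)"
    proof (intro exI[of _ "\<lambda>t. ball t (r t) \<inter> \<gamma>N t"] conjI allI impI)
      show "gauge (\<lambda>t. ball t (r t) \<inter> \<gamma>N t)"
        using r(1) \<gamma>N(1) by (auto simp: gauge_def)
      fix \<D> assume "\<D> tagged_division_of {p..q} \<and> (\<lambda>t. ball t (r t) \<inter> \<gamma>N t) fine \<D>"
      then have \<D>: "\<D> tagged_division_of {p..q}" and fine: "(\<lambda>t. ball t (r t)) fine \<D>" "\<gamma>N fine \<D>"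
        by (auto simp: fine_def)
      define E where "E = {z \<in> \<D>. fst z \<in> N}"
      have fin: "finite \<D>" using \<D> by auto
      have D: "\<exists>u v. K = {u..v} \<and> u \<le> t \<and> t \<le> v \<and> p \<le> u \<and> v \<le> q \<and> {u..v} \<subseteq> ball t (r t)"
        if tK: "(t, K) \<in> \<D>" for t K
      proof -
        obtain u v where K: "K = {u..v}"
          using tagged_division_ofD(4)[OF \<D> tK] by (auto simp: box_real)
        then show ?thesis
          using tagged_division_ofD(2,3)[OF \<D> tK] fineD[OF fine(1) tK] by auto
      qed
      have local: "\<bar>measure lborel K * g' t - (f (Sup K) - f (Inf K))\<bar> \<le> d * (Sup K - Inf K)"
        if tK: "(t, K) \<in> \<D> - E" for t K
      proof -
        obtain u v where K: "K = {u..v}" and uv: "u \<le> t" "t \<le> v" "p \<le> u" "v \<le> q" "{u..v} \<subseteq> ball t (r t)"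
          using D tK by blast
        have t: "t \<in> {p..q} - N" using tK uv by (auto simp: E_def)
        have "u \<in> ball t (r t)" "v \<in> ball t (r t)"
          by (rule subsetD[OF uv(5)], use uv(1,2) in simp)+
        then have "\<bar>u - t\<bar> < r t" "\<bar>v - t\<bar> < r t" by (auto simp: dist_real_def)
        moreover have "u \<in> {p..q}" "v \<in> {p..q}" using uv by auto
        ultimately have "\<bar>f u - f t - g t * (u - t)\<bar> \<le> d * \<bar>u - t\<bar>" "\<bar>f v - f t - g t * (v - t)\<bar> \<le> d * \<bar>v - t\<bar>"
          using r(2)[OF t] by blast+
        moreover have "d * \<bar>u - t\<bar> + d * \<bar>v - t\<bar> = d * (v - u)"
          using uv by (simp add: algebra_simps)
        \<comment> \<open>The increment over the interval is split at its tag; as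
          \<open>u \<le> t \<le> v\<close>, the two errors add up to at most
          \<open>d * (v - u)\<close>.\<close>
        moreover have "(v - u) * g t - (f v - f u) = (f u - f t - g t * (u - t)) - (f v - f t - g t * (v - t))"
          by (simp add: algebra_simps)
        ultimately show ?thesis using t uv by (simp add: K g'_def)
      qed
      have tel: "f q - f p = (\<Sum>(t, K)\<in>\<D>. f (Sup K) - f (Inf K))"
        "q - p = (\<Sum>(t, K)\<in>\<D>. Sup K - Inf K)"
        using additive_tagged_division_1[OF \<open>p \<le> q\<close> \<D>, of f]
          additive_tagged_division_1[OF \<open>p \<le> q\<close> \<D>, of "\<lambda>t. t"] by auto
      have nn: "0 \<le> (case z of (t, K) \<Rightarrow> Sup K - Inf K)" if "z \<in> \<D>" for z
        using D that by (cases z) fastforce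
      have "\<bar>(\<Sum>(t, K)\<in>\<D>. measure lborel K * g' t) - (f q - f p)\<bar>
          = \<bar>\<Sum>(t, K)\<in>\<D>. measure lborel K * g' t - (f (Sup K) - f (Inf K))\<bar>"
        by (simp add: tel(1) sum_subtractf case_prod_unfold)
      also have "\<dots> = \<bar>(\<Sum>(t, K)\<in>\<D> - E. measure lborel K * g' t - (f (Sup K) - f (Inf K)))
          + (\<Sum>(t, K)\<in>E. measure lborel K * g' t - (f (Sup K) - f (Inf K)))\<bar>"
        by (subst sum.subset_diff[of E]) (use fin in \<open>auto simp: E_def\<close>)
      also have "\<dots> \<le> (\<Sum>(t, K)\<in>\<D> - E. \<bar>measure lborel K * g' t - (f (Sup K) - f (Inf K))\<bar>)
          + (\<Sum>(t, K)\<in>E. \<bar>measure lborel K * g' t - (f (Sup K) - f (Inf K))\<bar>)"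
        unfolding case_prod_unfold by (intro order.trans[OF abs_triangle_ineq] add_mono sum_abs)
      also have "(\<Sum>(t, K)\<in>\<D> - E. \<bar>measure lborel K * g' t - (f (Sup K) - f (Inf K))\<bar>)
          \<le> (\<Sum>(t, K)\<in>\<D> - E. d * (Sup K - Inf K))"
        by (rule sum_mono) (use local in auto)
      also have "\<dots> = d * (\<Sum>(t, K)\<in>\<D> - E. Sup K - Inf K)"
        by (simp add: sum_distrib_left case_prod_unfold)
      also have "\<dots> \<le> d * (q - p)"
        unfolding tel(2) using \<open>0 < d\<close> fin nn by (intro mult_left_mono sum_mono2) auto
      also have "(\<Sum>(t, K)\<in>E. \<bar>measure lborel K * g' t - (f (Sup K) - f (Inf K))\<bar>)
          = (\<Sum>(t, K)\<in>E. \<bar>f (Sup K) - f (Inf K)\<bar>)"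
        by (rule sum.cong) (auto simp: E_def g'_def)
      also have "\<dots> < d"
        using \<gamma>N(2) \<D> fine(2) by (simp add: E_def)
      finally show "norm ((\<Sum>(t, K)\<in>\<D>. measure lborel K *\<^sub>R g' t) - (f q - f p)) < e"
        using \<open>d * (q - p) + d = e\<close> by simp
    qed
  qed
  then show ?thesis
    by (rule has_integral_spike[OF N, rotated]) (auto simp: g'_def)
qed

section \<open>The bound after a zero\<close>

text \<open>Replaces the substitution \<open>w = C r\<close>, which would need the differentiability of the
  indefinite integral \<open>C\<close> almost everywhere. Halving the increment of \<open>C\<close> repeatedly improves the
  constant \<open>L\<close> to \<open>L / 2 ^ n\<close>.\<close>

lemma le_of_quadratic_increments:
  fixes F C :: "real \<Rightarrow> real"
  assumes "a \<le> b" and cont: "continuous_on {a..b} C"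
    and mono: "\<And>s t. a \<le> s \<Longrightarrow> s \<le> t \<Longrightarrow> t \<le> b \<Longrightarrow> C s \<le> C t"
    and incr: "\<And>s t. a \<le> s \<Longrightarrow> s \<le> t \<Longrightarrow> t \<le> b \<Longrightarrow> F t - F s \<le> L * (C t - C s)\<^sup>2"
  shows "F b \<le> F a"
proof -
  have halved: "F t - F s \<le> L * (C t - C s)\<^sup>2 / 2 ^ n" if "a \<le> s" "s \<le> t" "t \<le> b" for n s t
    using that
  proof (induction n arbitrary: s t)
    case 0
    then show ?case using incr by simp
  next
    case (Suc n)
    \<comment> \<open>Splitting where \<open>C\<close> takes the mean of its end values gives two
      pieces with a quarter of the square each, hence half of it together.\<close>
    have "\<exists>r. s \<le> r \<and> r \<le> t \<and> C r = (C s + C t) / 2"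
      by (rule IVT') (use Suc.prems mono[of s t] continuous_on_subset[OF cont, of "{s..t}"] in auto)
    then obtain r where r: "s \<le> r" "r \<le> t" "C r = (C s + C t) / 2" by blast
    have "F r - F s \<le> L * (C r - C s)\<^sup>2 / 2 ^ n" "F t - F r \<le> L * (C t - C r)\<^sup>2 / 2 ^ n"
      using Suc r by auto
    moreover have "L * (C r - C s)\<^sup>2 / 2 ^ n + L * (C t - C r)\<^sup>2 / 2 ^ n = L * (C t - C s)\<^sup>2 / 2 ^ Suc n"
      unfolding r(3) by (simp add: field_simps power2_eq_square)
    ultimately show ?case by linarith
  qed
  have "(\<lambda>n. L * (C b - C a)\<^sup>2 * (1 / 2) ^ n) \<longlonglongrightarrow> L * (C b - C a)\<^sup>2 * 0"
    by (intro tendsto_intros LIMSEQ_power_zero) auto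
  then have "F b - F a \<le> L * (C b - C a)\<^sup>2 * 0"
    by (rule LIMSEQ_le_const) (use halved[of a b] \<open>a \<le> b\<close> in \<open>auto simp: power_divide\<close>)
  then show ?thesis by simp
qed

text \<open>With \<open>y = K - w\<close> this is the integrand \<open>min 1 (K - w)\<close>, cut
  off at 0 because \<open>w\<close> may exceed \<open>K\<close> on a long phase.\<close>

definition clamp01 :: "real \<Rightarrow> real" where
  "clamp01 y = max 0 (min 1 y)"

text \<open>The antiderivative of \<^const>\<open>clamp01\<close>.\<close>

definition huber :: "real \<Rightarrow> real" where
  "huber y = (if y \<le> 0 then 0 else if y \<le> 1 then y\<^sup>2 / 2 else y - 1 / 2)"

lemma huber_nonneg: "0 \<le> huber y"
  by (auto simp: huber_def)

text \<open>A first-order Taylor estimate at \<open>y\<close>: the derivative \<open>clamp01\<close>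
  of \<open>huber\<close> is 1-Lipschitz, so the error is at most half the square, and the cruder
  factor 1 suffices. An error of this order is what \<open>le_of_quadratic_increments\<close>
  tolerates.\<close>

lemma clamp01_huber:
  assumes "z \<le> y"
  shows "clamp01 y * (y - z) \<le> huber y - huber z + (y - z)\<^sup>2"
proof -
  have sq: "0 \<le> (y - z)\<^sup>2" "0 \<le> y\<^sup>2" "0 \<le> z\<^sup>2" by simp_all
  consider "y \<le> 0" | "0 < y" "y \<le> 1" "z \<le> 0" | "0 < y" "y \<le> 1" "0 < z"
    | "1 < y" "z \<le> 0" | "1 < y" "0 < z" "z \<le> 1" | "1 < z" using assms by linarith
  then show ?thesis
  proof cases
    case 1
    then show ?thesis using assms by (simp add: clamp01_def huber_def)
  next
    case 2
    then have "y * z \<le> 0" by (simp add: mult_nonneg_nonpos)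
    moreover have "y * (y - z) = y\<^sup>2 / 2 + (y - z)\<^sup>2 - (y\<^sup>2 / 2 - y * z + z\<^sup>2)"
      by (simp add: power2_eq_square algebra_simps)
    ultimately have "y * (y - z) \<le> y\<^sup>2 / 2 + (y - z)\<^sup>2" using sq by linarith
    then show ?thesis using 2 by (simp add: clamp01_def huber_def)
  next
    case 3
    have "y * (y - z) = y\<^sup>2 / 2 - z\<^sup>2 / 2 + (y - z)\<^sup>2 - (y - z)\<^sup>2 / 2"
      by (simp add: power2_eq_square field_simps)
    then have "y * (y - z) \<le> y\<^sup>2 / 2 - z\<^sup>2 / 2 + (y - z)\<^sup>2" using sq by linarith
    then show ?thesis using 3 assms by (simp add: clamp01_def huber_def)
  next
    case 4
    then have "(y - z) * 1 \<le> (y - z) * (y - z)" by (intro mult_left_mono) auto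
    then have "y - z \<le> (y - z)\<^sup>2" by (simp add: power2_eq_square)
    then have "y - z \<le> y - 1 / 2 + (y - z)\<^sup>2" using 4 by linarith
    then show ?thesis using 4 by (simp add: clamp01_def huber_def)
  next
    case 5
    \<comment> \<open>In this case the claim amounts to
      \<open>(1 - z)\<^sup>2 / 2 \<le> (y - z)\<^sup>2\<close>.\<close>
    then have "(1 - z)\<^sup>2 \<le> (y - z)\<^sup>2" by (intro power_mono) auto
    moreover have "(1 - z)\<^sup>2 = 1 - 2 * z + z\<^sup>2" by (simp add: power2_eq_square algebra_simps)
    ultimately have "y - z \<le> y - 1 / 2 - z\<^sup>2 / 2 + (y - z)\<^sup>2" using sq by linarith
    then show ?thesis using 5 by (simp add: clamp01_def huber_def)
  next
    case 6
    then show ?thesis using assms by (simp add: clamp01_def huber_def)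
  qed
qed

text \<open>In the variable \<open>w = C t - C \<xi>\<close>, the estimate compares
  \<open>x t + B * huber (K - w)\<close> at \<open>\<xi>\<close> and at \<open>s\<close>; its value
  at \<open>\<xi>\<close> is \<open>B * huber K\<close>. The bound on \<open>x (\<tau> v)\<close> in
  the history controls the slope of \<open>x\<close> between \<open>\<tau> r\<close> and
  \<open>\<xi>\<close>.\<close>

lemma nonneg_phase_bound:
  fixes x c \<tau> C :: "real \<Rightarrow> real"
  assumes "t0 \<le> \<xi>" "\<xi> \<le> s" "1 \<le> K" "x \<xi> = 0"
    and nonneg: "\<And>u. \<xi> \<le> u \<Longrightarrow> u \<le> s \<Longrightarrow> 0 \<le> x u"
    and c_nonneg: "\<And>u. t0 \<le> u \<Longrightarrow> 0 \<le> c u"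
    and C: "\<And>u v. t0 \<le> u \<Longrightarrow> u \<le> v \<Longrightarrow> (c has_integral C v - C u) {u..v}"
    and C_cont: "continuous_on {t0..s} C"
    and x: "\<And>u v. t0 \<le> u \<Longrightarrow> u \<le> v \<Longrightarrow> ((\<lambda>r. - (c r * x (\<tau> r))) has_integral x v - x u) {u..v}"
    and \<tau>: "\<And>u. \<xi> \<le> u \<Longrightarrow> u \<le> s \<Longrightarrow> t0 \<le> \<tau> u \<and> \<tau> u \<le> u \<and> C u - C (\<tau> u) \<le> K"
    and hist: "\<And>v. t0 \<le> v \<Longrightarrow> v \<le> \<xi> \<Longrightarrow> \<bar>x v\<bar> \<le> B \<and> \<bar>x (\<tau> v)\<bar> \<le> B"
  shows "x s \<le> B * (K - 1 / 2)"
proof -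
  have "0 \<le> B" using hist[of \<xi>] \<open>t0 \<le> \<xi>\<close> by auto
  have C_mono: "C u \<le> C v" if "t0 \<le> u" "u \<le> v" for u v
    using has_integral_nonneg[OF C[OF that]] c_nonneg that by auto
  define y where "y t = K - (C t - C \<xi>)" for t
  \<comment> \<open>The bound uses \<open>y t\<close> instead of the smaller \<open>y r\<close>, so
    that it is constant in \<open>r\<close> and can be taken out of the integral over
    \<open>{t..t'}\<close>.\<close>
  have slope: "- x (\<tau> r) \<le> B * clamp01 (y t)" if "\<xi> \<le> t" "t \<le> r" "r \<le> s" for t r
  proof (cases "\<xi> \<le> \<tau> r")
    case True
    then have "0 \<le> x (\<tau> r)" using \<tau>[of r] that by (intro nonneg) auto
    moreover have "0 \<le> B * clamp01 (y t)" using \<open>0 \<le> B\<close> by (simp add: clamp01_def)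
    ultimately show ?thesis by linarith
  next
    case False
    have r: "t0 \<le> \<tau> r" "C r - C (\<tau> r) \<le> K" using \<tau>[of r] that by auto
    have "x \<xi> - x (\<tau> r) \<le> B * (C \<xi> - C (\<tau> r))"
    proof (rule has_integral_le)
      show "((\<lambda>v. - (c v * x (\<tau> v))) has_integral x \<xi> - x (\<tau> r)) {\<tau> r..\<xi>}"
        using r False by (intro x) auto
      show "((\<lambda>v. B * c v) has_integral B * (C \<xi> - C (\<tau> r))) {\<tau> r..\<xi>}"
        using r False by (intro has_integral_mult_right C) auto
      fix v assume "v \<in> {\<tau> r..\<xi>}"
      then have "0 \<le> c v" "- x (\<tau> v) \<le> B" using hist[of v] c_nonneg[of v] r by auto
      then have "c v * (- x (\<tau> v)) \<le> c v * B" by (intro mult_left_mono)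
      then show "- (c v * x (\<tau> v)) \<le> B * c v" by (simp add: mult.commute)
    qed
    moreover have "C \<xi> - C (\<tau> r) \<le> y t"
      using r C_mono[of t r] that \<open>t0 \<le> \<xi>\<close> by (simp add: y_def)
    then have "B * (C \<xi> - C (\<tau> r)) \<le> B * y t" using \<open>0 \<le> B\<close> by (rule mult_left_mono)
    moreover have "- x (\<tau> r) \<le> B" using hist[of "\<tau> r"] r False by auto
    moreover have "0 \<le> y t" using \<open>C \<xi> - C (\<tau> r) \<le> y t\<close> C_mono[of "\<tau> r" \<xi>] r False by auto
    ultimately show ?thesis using \<open>x \<xi> = 0\<close> by (auto simp: clamp01_def min_def)
  qed
  \<comment> \<open>The second summand is \<open>B\<close> times the integral of
    \<open>clamp01\<close> from 0 to \<open>y t\<close>, a bound for what \<open>x\<close> can still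
    gain after \<open>t\<close>.\<close>
  define F where "F t = x t + B * huber (y t)" for t
  have "F s \<le> F \<xi>"
  proof (rule le_of_quadratic_increments[where F = F and C = C and L = B])
    show "continuous_on {\<xi>..s} C"
      using C_cont by (rule continuous_on_subset) (use \<open>t0 \<le> \<xi>\<close> in auto)
    fix t t' assume t: "\<xi> \<le> t" "t \<le> t'" "t' \<le> s"
    then show "C t \<le> C t'" using C_mono \<open>t0 \<le> \<xi>\<close> by simp
    have "x t' - x t \<le> B * clamp01 (y t) * (C t' - C t)"
    proof (rule has_integral_le)
      show "((\<lambda>r. - (c r * x (\<tau> r))) has_integral x t' - x t) {t..t'}"
        using t \<open>t0 \<le> \<xi>\<close> by (intro x) auto
      show "((\<lambda>r. B * clamp01 (y t) * c r) has_integral B * clamp01 (y t) * (C t' - C t)) {t..t'}"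
        using t \<open>t0 \<le> \<xi>\<close> by (intro has_integral_mult_right C) auto
      fix r assume "r \<in> {t..t'}"
      then have "c r * (- x (\<tau> r)) \<le> c r * (B * clamp01 (y t))"
        using t \<open>t0 \<le> \<xi>\<close> by (intro mult_left_mono slope c_nonneg) auto
      then show "- (c r * x (\<tau> r)) \<le> B * clamp01 (y t) * c r" by (simp add: mult_ac)
    qed
    moreover have "y t' \<le> y t" "C t' - C t = y t - y t'"
      using \<open>C t \<le> C t'\<close> by (auto simp: y_def)
    moreover from this have "B * (clamp01 (y t) * (C t' - C t))
        \<le> B * (huber (y t) - huber (y t') + (C t' - C t)\<^sup>2)"
      using clamp01_huber \<open>0 \<le> B\<close> by (intro mult_left_mono) auto
    then have "B * clamp01 (y t) * (C t' - C t)
        \<le> B * huber (y t) - B * huber (y t') + B * (C t' - C t)\<^sup>2"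
      by (simp only: mult.assoc distrib_left right_diff_distrib)
    ultimately show "F t' - F t \<le> B * (C t' - C t)\<^sup>2"
      unfolding F_def by linarith
  qed (use \<open>\<xi> \<le> s\<close> in auto)
  moreover have "F \<xi> = B * (K - 1 / 2)"
    \<comment> \<open>At \<open>K = 1\<close> the quadratic branch of \<open>huber\<close> applies;
      both branches give 1/2 there.\<close>
    using \<open>1 \<le> K\<close> \<open>x \<xi> = 0\<close> by (cases "K = 1") (auto simp: F_def y_def huber_def)
  moreover have "0 \<le> B * huber (y s)" using \<open>0 \<le> B\<close> huber_nonneg by simp
  ultimately show ?thesis by (simp add: F_def)
qed

section \<open>The last zero and solutions of either sign\<close>

text \<open>The largest zero in \<open>{z..s}\<close> serves as \<open>\<xi>\<close>: a change of
  sign after it would produce a later zero.\<close>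

lemma last_zero_constant_sign:
  fixes x :: "real \<Rightarrow> real"
  assumes "z \<le> s" "x z = 0" and cont: "continuous_on {z..s} x"
  obtains \<xi> where "z \<le> \<xi>" "\<xi> \<le> s" "x \<xi> = 0"
    "(\<forall>u\<in>{\<xi>..s}. 0 \<le> x u) \<or> (\<forall>u\<in>{\<xi>..s}. x u \<le> 0)"
proof -
  define Z where "Z = {u \<in> {z..s}. x u = 0}"
  have "compact Z"
    unfolding compact_eq_bounded_closed
  proof
    show "closed Z"
      unfolding Z_def by (rule continuous_closed_preimage_constant[OF cont]) simp
    show "bounded Z" by (rule bounded_subset[of "{z..s}"]) (auto simp: Z_def)
  qed
  moreover have "Z \<noteq> {}" using assms by (auto simp: Z_def)
  ultimately obtain \<xi> where \<xi>: "\<xi> \<in> Z" "\<And>u. u \<in> Z \<Longrightarrow> u \<le> \<xi>"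
    using compact_attains_sup by metis
  have no_sign_change: False if uv: "\<xi> < u" "\<xi> < v" "u \<le> s" "v \<le> s" "x u < 0" "0 < x v" for u v
  proof -
    have cont': "continuous_on {min u v..max u v} x"
      by (rule continuous_on_subset[OF cont]) (use uv \<xi>(1) in \<open>auto simp: Z_def\<close>)
    have "connected (x ` {min u v..max u v})"
      by (intro connected_continuous_image cont') simp
    moreover have "x u \<in> x ` {min u v..max u v}" "x v \<in> x ` {min u v..max u v}" by auto
    ultimately have "0 \<in> x ` {min u v..max u v}"
      using uv by (auto intro!: connectedD_interval[of _ "x u" "x v" 0])
    then obtain w where "w \<in> {min u v..max u v}" "x w = 0" by auto
    then have "w \<in> Z" "\<xi> < w" using uv \<xi>(1) by (auto simp: Z_def min_def max_def split: if_splits)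
    then show False using \<xi>(2) by fastforce
  qed
  show thesis
  proof (rule that[of \<xi>])
    show "(\<forall>u\<in>{\<xi>..s}. 0 \<le> x u) \<or> (\<forall>u\<in>{\<xi>..s}. x u \<le> 0)"
    proof (rule ccontr)
      assume "\<not> ?thesis"
      then obtain u v where "u \<in> {\<xi>..s}" "v \<in> {\<xi>..s}" "x u < 0" "0 < x v"
        by (auto simp: not_le)
      moreover from this have "u \<noteq> \<xi>" "v \<noteq> \<xi>" using \<xi>(1) by (auto simp: Z_def)
      ultimately show False using no_sign_change[of u v] by auto
    qed
  qed (use \<xi>(1) in \<open>auto simp: Z_def\<close>)
qed

text \<open>The equation is linear, so a nonpositive phase is handled by passing to
  \<open>- x\<close>. Since \<open>\<xi>\<close> is obtained before \<open>B\<close> is quantified,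
  \<open>B\<close> may depend on \<open>\<xi>\<close>.\<close>

lemma bound_after_zero:
  fixes x c \<tau> C :: "real \<Rightarrow> real"
  assumes "t0 \<le> z" "z \<le> s" "1 \<le> K" "x z = 0"
    and c_nonneg: "\<And>u. t0 \<le> u \<Longrightarrow> 0 \<le> c u"
    and C: "\<And>u v. t0 \<le> u \<Longrightarrow> u \<le> v \<Longrightarrow> (c has_integral C v - C u) {u..v}"
    and C_cont: "continuous_on {t0..s} C"
    and x: "\<And>u v. t0 \<le> u \<Longrightarrow> u \<le> v \<Longrightarrow> ((\<lambda>r. - (c r * x (\<tau> r))) has_integral x v - x u) {u..v}"
    and x_cont: "continuous_on {t0..s} x"
    and \<tau>: "\<And>u. z \<le> u \<Longrightarrow> u \<le> s \<Longrightarrow> t0 \<le> \<tau> u \<and> \<tau> u \<le> u \<and> C u - C (\<tau> u) \<le> K"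
  obtains \<xi> where "z \<le> \<xi>" "\<xi> \<le> s" "x \<xi> = 0"
    "\<And>B. (\<And>v. t0 \<le> v \<Longrightarrow> v \<le> \<xi> \<Longrightarrow> \<bar>x v\<bar> \<le> B \<and> \<bar>x (\<tau> v)\<bar> \<le> B) \<Longrightarrow> \<bar>x s\<bar> \<le> B * (K - 1 / 2)"
proof -
  obtain \<xi> where \<xi>: "z \<le> \<xi>" "\<xi> \<le> s" "x \<xi> = 0"
    and sign: "(\<forall>u\<in>{\<xi>..s}. 0 \<le> x u) \<or> (\<forall>u\<in>{\<xi>..s}. x u \<le> 0)"
  proof (rule last_zero_constant_sign[of z s x])
    show "continuous_on {z..s} x" by (rule continuous_on_subset[OF x_cont]) (use \<open>t0 \<le> z\<close> in auto)
  qed (use assms(2,4) in auto)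
  show thesis
  proof (rule that[OF \<xi>])
    fix B assume hist: "\<And>v. t0 \<le> v \<Longrightarrow> v \<le> \<xi> \<Longrightarrow> \<bar>x v\<bar> \<le> B \<and> \<bar>x (\<tau> v)\<bar> \<le> B"
    have "t0 \<le> \<xi>" using \<xi> \<open>t0 \<le> z\<close> by simp
    from sign show "\<bar>x s\<bar> \<le> B * (K - 1 / 2)"
    proof
      assume "\<forall>u\<in>{\<xi>..s}. 0 \<le> x u"
      then have "x s \<le> B * (K - 1 / 2)" "0 \<le> x s"
        using \<xi> by (auto intro!: nonneg_phase_bound[OF \<open>t0 \<le> \<xi>\<close> \<open>\<xi> \<le> s\<close> \<open>1 \<le> K\<close> \<open>x \<xi> = 0\<close> _ c_nonneg C C_cont x \<tau> hist])
      then show ?thesis by simp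
    next
      assume neg: "\<forall>u\<in>{\<xi>..s}. x u \<le> 0"
      have "- x s \<le> B * (K - 1 / 2)"
      proof (rule nonneg_phase_bound[OF \<open>t0 \<le> \<xi>\<close> \<open>\<xi> \<le> s\<close> \<open>1 \<le> K\<close>, where x = "\<lambda>t. - x t" and c = c and C = C and \<tau> = \<tau>])
        fix u v assume "t0 \<le> u" "u \<le> v"
        from has_integral_neg[OF x[OF this]]
        show "((\<lambda>r. - (c r * - x (\<tau> r))) has_integral - x v - - x u) {u..v}" by simp
      qed (use \<xi> neg c_nonneg C C_cont \<tau> hist in auto)
      moreover have "x s \<le> 0" using neg \<xi> by auto
      ultimately show ?thesis by simp
    qed
  qed
qed

section \<open>Oscillatory solutions\<close>

text \<open>Here \<open>m\<close> is the left end of the domain of the solution and \<open>C\<close>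
  an antiderivative of \<open>c\<close>, so the delay integrals become differences of
  \<open>C\<close>. The requirement \<open>1 \<le> K\<close> is no restriction, since a smaller
  bound can be raised to 1.\<close>

locale oscillatory_solution =
  fixes c \<tau> C x :: "real \<Rightarrow> real" and m t0 K :: real
  assumes m_le: "m \<le> t0"
    and c_nonneg: "\<And>u. t0 \<le> u \<Longrightarrow> 0 \<le> c u"
    and C: "\<And>u v. t0 \<le> u \<Longrightarrow> u \<le> v \<Longrightarrow> (c has_integral C v - C u) {u..v}"
    and C_cont: "continuous_on {t0..} C"
    and x: "\<And>u v. t0 \<le> u \<Longrightarrow> u \<le> v \<Longrightarrow> ((\<lambda>r. - (c r * x (\<tau> r))) has_integral x v - x u) {u..v}"
    and x_cont: "continuous_on {m..} x"
    and \<tau>: "\<And>u. t0 \<le> u \<Longrightarrow> m \<le> \<tau> u \<and> \<tau> u \<le> u \<and> C u - C (\<tau> u) \<le> K"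
    and \<tau>_lim: "filterlim \<tau> at_top at_top"
    and zeros: "\<And>T. \<exists>t\<ge>T. x t = 0"
    and K: "1 \<le> K" "K \<le> 3 / 2"
begin

text \<open>The estimate can be restarted at any later \<open>T\<close>, so that only the history
  from \<open>T\<close> on counts. Boundedness uses \<open>T = t0\<close>, decay uses large
  \<open>T\<close>.\<close>

lemma bound_after_zero_from:
  assumes "t0 \<le> T" "T \<le> z" "z \<le> s" "x z = 0" and "\<And>u. z \<le> u \<Longrightarrow> T \<le> \<tau> u"
  obtains \<xi> where "z \<le> \<xi>" "\<xi> \<le> s" "x \<xi> = 0"
    "\<And>B. (\<And>v. T \<le> v \<Longrightarrow> v \<le> \<xi> \<Longrightarrow> \<bar>x v\<bar> \<le> B \<and> \<bar>x (\<tau> v)\<bar> \<le> B) \<Longrightarrow> \<bar>x s\<bar> \<le> B * (K - 1 / 2)"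
proof (rule bound_after_zero[of T z s K x c C \<tau>])
  show "continuous_on {T..s} C" by (rule continuous_on_subset[OF C_cont]) (use assms in auto)
  show "continuous_on {T..s} x" by (rule continuous_on_subset[OF x_cont]) (use assms m_le in auto)
qed (use assms c_nonneg C x \<tau> K that in auto)

lemma zero_beyond:
  obtains z where "T \<le> z" "x z = 0" "\<And>u. z \<le> u \<Longrightarrow> T \<le> \<tau> u"
proof -
  obtain S where S: "\<And>u. S \<le> u \<Longrightarrow> T \<le> \<tau> u"
    using \<tau>_lim by (auto simp: filterlim_at_top eventually_at_top_linorder)
  obtain z where "max S T \<le> z" "x z = 0" using zeros by blast
  with S show thesis by (intro that[of z]) auto
qed

text \<open>The maximum of \<open>\<bar>x\<bar>\<close> up to \<open>z\<close> bounds it everywhere.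
  Otherwise take the first point \<open>s\<close> where a larger maximum over \<open>{m..t}\<close>
  is attained: the estimate shows that this value was already attained up to the preceding zero
  \<open>\<xi>\<close>.\<close>

lemma bounded_solution: "bounded (x ` {m..})"
proof -
  obtain z where z: "t0 \<le> z" "x z = 0" "\<And>u. z \<le> u \<Longrightarrow> t0 \<le> \<tau> u"
    using zero_beyond[of t0] by metis
  have abs_cont: "continuous_on {m..q} (\<lambda>t. \<bar>x t\<bar>)" for q
    by (intro continuous_on_rabs continuous_on_subset[OF x_cont]) auto
  have attains: "\<exists>w\<in>{m..q}. \<forall>u\<in>{m..q}. \<bar>x u\<bar> \<le> \<bar>x w\<bar>" if "m \<le> q" for q
    using that by (intro continuous_attains_sup abs_cont) auto
  have "m \<le> z" using z m_le by simp
  then obtain b where b: "\<And>t. t \<in> {m..z} \<Longrightarrow> \<bar>x t\<bar> \<le> \<bar>x b\<bar>"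
    using attains by blast
  have "\<bar>x t\<bar> \<le> \<bar>x b\<bar>" if t: "m \<le> t" for t
  proof (rule ccontr)
    assume big: "\<not> \<bar>x t\<bar> \<le> \<bar>x b\<bar>"
    then have "z < t" using b t by fastforce
    obtain w where w: "w \<in> {m..t}" and max: "\<And>u. u \<in> {m..t} \<Longrightarrow> \<bar>x u\<bar> \<le> \<bar>x w\<bar>"
      using attains[OF t] by blast
    define S where "S = {u \<in> {m..t}. \<bar>x u\<bar> = \<bar>x w\<bar>}"
    have "compact S"
      unfolding compact_eq_bounded_closed
    proof
      show "closed S"
        unfolding S_def by (rule continuous_closed_preimage_constant[OF abs_cont]) simp
      show "bounded S" by (rule bounded_subset[of "{m..t}"]) (auto simp: S_def)
    qed
    moreover have "S \<noteq> {}" using w by (auto simp: S_def)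
    ultimately obtain s where s: "s \<in> S" "\<And>u. u \<in> S \<Longrightarrow> s \<le> u"
      using compact_attains_inf by metis
    have xs: "\<bar>x s\<bar> = \<bar>x w\<bar>" and "s \<le> t" using s by (auto simp: S_def)
    have "\<bar>x b\<bar> < \<bar>x s\<bar>" using max[of t] big xs t by auto
    then have "z \<le> s" using b[of s] s(1) by (cases "s \<le> z") (auto simp: S_def)
    obtain \<xi> where \<xi>: "z \<le> \<xi>" "\<xi> \<le> s" "x \<xi> = 0"
      and bound: "\<And>B. (\<And>v. t0 \<le> v \<Longrightarrow> v \<le> \<xi> \<Longrightarrow> \<bar>x v\<bar> \<le> B \<and> \<bar>x (\<tau> v)\<bar> \<le> B) \<Longrightarrow>
        \<bar>x s\<bar> \<le> B * (K - 1 / 2)"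
      by (rule bound_after_zero_from[OF order_refl z(1) \<open>z \<le> s\<close> z(2,3)]) auto
    have "m \<le> \<xi>" using \<xi> z m_le by linarith
    \<comment> \<open>The maximum up to \<open>\<xi>\<close> is an admissible \<open>B\<close>,
      because \<open>m \<le> \<tau> v \<le> v \<le> \<xi>\<close> for the relevant
      \<open>v\<close>.\<close>
    then obtain r where r: "r \<in> {m..\<xi>}" "\<And>u. u \<in> {m..\<xi>} \<Longrightarrow> \<bar>x u\<bar> \<le> \<bar>x r\<bar>"
      using attains by blast
    have "\<bar>x s\<bar> \<le> \<bar>x r\<bar> * (K - 1 / 2)"
    proof (rule bound)
      fix v assume "t0 \<le> v" "v \<le> \<xi>"
      then show "\<bar>x v\<bar> \<le> \<bar>x r\<bar> \<and> \<bar>x (\<tau> v)\<bar> \<le> \<bar>x r\<bar>"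
        using \<tau>[of v] m_le by (auto intro!: r(2))
    qed
    also have "\<dots> \<le> \<bar>x r\<bar> * 1" using K by (intro mult_left_mono) auto
    finally have "\<bar>x r\<bar> = \<bar>x w\<bar>" using max[of r] r(1) \<xi> \<open>s \<le> t\<close> xs by fastforce
    then have "r \<in> S" using r(1) \<xi> \<open>s \<le> t\<close> by (auto simp: S_def)
    then have "s \<le> r" by (rule s(2))
    \<comment> \<open>From \<open>s \<le> r \<le> \<xi> \<le> s\<close>; but \<open>x\<close>
      vanishes at \<open>\<xi>\<close>, while \<open>\<bar>x s\<bar>\<close> exceeds
      \<open>\<bar>x b\<bar>\<close>.\<close>
    then have "s = \<xi>" using r(1) \<xi> by auto
    then show False using \<open>\<bar>x b\<bar> < \<bar>x s\<bar>\<close> \<xi> by simp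
  qed
  then show ?thesis by (auto simp: bounded_iff intro!: exI[of _ "\<bar>x b\<bar>"])
qed

text \<open>Induction on \<open>n\<close> yields a time after which \<open>n\<close> contractions by
  the factor \<open>K - 1 / 2 < 1\<close> have taken place.\<close>

lemma solution_tendsto_zero:
  assumes "K < 3 / 2"
  shows "(x \<longlongrightarrow> 0) at_top"
proof -
  obtain B where B: "\<And>t. m \<le> t \<Longrightarrow> \<bar>x t\<bar> \<le> B"
    using bounded_solution by (auto simp: bounded_iff)
  have decay: "\<exists>T\<ge>t0. \<forall>t\<ge>T. \<bar>x t\<bar> \<le> B * (K - 1 / 2) ^ n" for n
  proof (induction n)
    case 0
    then show ?case using B m_le by (intro exI[of _ t0]) auto
  next
    case (Suc n)
    then obtain T where T: "t0 \<le> T" "\<And>t. T \<le> t \<Longrightarrow> \<bar>x t\<bar> \<le> B * (K - 1 / 2) ^ n" by blast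
    \<comment> \<open>Two passages are needed: for \<open>v\<close> beyond \<open>T'\<close> both
      \<open>v\<close> and \<open>\<tau> v\<close> lie beyond \<open>T\<close>, where the bound for
      \<open>n\<close> holds; beyond \<open>z\<close> the delayed arguments stay beyond
      \<open>T'\<close>, where the estimate restarts.\<close>
    obtain T' where T': "T \<le> T'" "\<And>u. T' \<le> u \<Longrightarrow> T \<le> \<tau> u"
      using zero_beyond[of T] by metis
    obtain z where z: "T' \<le> z" "x z = 0" "\<And>u. z \<le> u \<Longrightarrow> T' \<le> \<tau> u"
      using zero_beyond[of T'] by metis
    have "\<bar>x s\<bar> \<le> B * (K - 1 / 2) ^ Suc n" if s: "z \<le> s" for s
    proof -
      have "t0 \<le> T'" using T T' by simp
      then obtain \<xi> where bound: "\<And>B. (\<And>v. T' \<le> v \<Longrightarrow> v \<le> \<xi> \<Longrightarrow> \<bar>x v\<bar> \<le> B \<and> \<bar>x (\<tau> v)\<bar> \<le> B) \<Longrightarrow>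
        \<bar>x s\<bar> \<le> B * (K - 1 / 2)"
        by (rule bound_after_zero_from[OF _ z(1) s z(2,3)]) auto
      have "\<bar>x s\<bar> \<le> B * (K - 1 / 2) ^ n * (K - 1 / 2)"
        by (rule bound) (use T T' in auto)
      then show ?thesis by (simp add: mult_ac)
    qed
    then show ?case using T T' z by (intro exI[of _ z]) auto
  qed
  have lim: "(\<lambda>n. B * (K - 1 / 2) ^ n) \<longlonglongrightarrow> B * 0"
    using K assms by (intro tendsto_intros LIMSEQ_power_zero) auto
  show ?thesis
  proof (rule tendstoI)
    fix e :: real assume "0 < e"
    then have "eventually (\<lambda>n. B * (K - 1 / 2) ^ n < e) sequentially"
      using order_tendstoD(2)[OF lim, of e] by simp
    then obtain n where "B * (K - 1 / 2) ^ n < e"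
      using eventually_happens'[OF sequentially_bot] by blast
    moreover obtain T where "\<And>t. T \<le> t \<Longrightarrow> \<bar>x t\<bar> \<le> B * (K - 1 / 2) ^ n" using decay by blast
    ultimately show "eventually (\<lambda>t. dist (x t) 0 < e) at_top"
      unfolding eventually_at_top_linorder by (intro exI[of _ T]) (fastforce simp: dist_real_def)
  qed
qed

end

section \<open>From the standing assumptions to the abstract setting\<close>

text \<open>Some element of the set lies below \<open>\<rho>\<close>, and
  \<open>tau_min \<tau>\<close> is nondecreasing.\<close>

lemma tau_min_pos_beyond:
  assumes "filterlim \<tau> at_top at_top" and "\<rho> > Inf {t. t > 0 \<and> tau_min \<tau> t > ereal a}"
    and "\<rho> \<le> t0"
  shows "0 < t0" "ereal a < tau_min \<tau> t0"
proof -
  obtain T where T: "\<And>v. T \<le> v \<Longrightarrow> a + 1 \<le> \<tau> v"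
    using assms(1) by (auto simp: filterlim_at_top eventually_at_top_linorder)
  \<comment> \<open>The set must be nonempty before its infimum yields an element. The margin 1
    keeps the inequality strict after taking the infimum, and \<open>max T 1\<close> is
    positive.\<close>
  have "ereal (a + 1) \<le> tau_min \<tau> (max T 1)"
    unfolding tau_min_def by (rule INF_greatest) (use T in auto)
  then have "ereal a < tau_min \<tau> (max T 1)" by (rule less_le_trans[rotated]) simp
  then have "{t. t > 0 \<and> tau_min \<tau> t > ereal a} \<noteq> {}"
    by (auto intro!: exI[of _ "max T 1"])
  then obtain t1 where t1: "0 < t1" "ereal a < tau_min \<tau> t1" "t1 < \<rho>"
    using cInf_lessD[OF _ assms(2)] by blast
  moreover have "tau_min \<tau> t1 \<le> tau_min \<tau> t0"
    unfolding tau_min_def by (rule INF_superset_mono) (use t1 assms(3) in auto)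
  ultimately show "0 < t0" "ereal a < tau_min \<tau> t0" using assms(3) by auto
qed

text \<open>The null set on which the differential equation may fail serves as the exceptional set
  of the fundamental theorem of calculus.\<close>

lemma is_solution_has_integral:
  assumes "is_solution c \<tau> t0 x" "sol_domain \<tau> t0 = {m..}" "m \<le> t0" "t0 \<le> u" "u \<le> v"
  shows "((\<lambda>r. - (c r * x (\<tau> r))) has_integral x v - x u) {u..v}"
proof -
  have "AE t in lebesgue. t \<in> {t0..} \<longrightarrow> x differentiable (at t) \<and> deriv x t + c t * x (\<tau> t) = 0"
    using assms(1) by (simp add: is_solution_def)
  then obtain N where N: "N \<in> null_sets lebesgue"
    "\<And>t. t \<notin> N \<Longrightarrow> t0 \<le> t \<Longrightarrow> x differentiable (at t) \<and> deriv x t + c t * x (\<tau> t) = 0"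
    by (auto simp: eventually_ae_filter)
  show ?thesis
  proof (rule abs_cont_has_integral_derivative[OF \<open>u \<le> v\<close>])
    show "abs_cont_interval u v x"
      using assms by (auto simp: is_solution_def loc_abs_cont_on_def)
    show "negligible N" using N by (simp add: negligible_iff_null_sets)
    fix t assume "t \<in> {u..v} - N"
    then have "x differentiable (at t)" "deriv x t = - (c t * x (\<tau> t))"
      using N(2)[of t] \<open>t0 \<le> u\<close> by auto
    then have "(x has_real_derivative - (c t * x (\<tau> t))) (at t)"
      by (metis DERIV_deriv_iff_real_differentiable)
    then show "(x has_real_derivative - (c t * x (\<tau> t))) (at t within {u..v})"
      by (rule has_field_derivative_at_within)
  qed
qed

text \<open>Beyond \<open>\<rho>\<close> the infimum of the delayed arguments is a real
  \<open>m \<ge> 0\<close>. Hence the domain is a closed half-line, and all delay intervals lie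
  where \<open>c\<close> is nonnegative and locally integrable.\<close>

lemma oscillatory_solutionI:
  assumes c_loc_integrable: "\<And>t. t \<ge> 0 \<Longrightarrow> set_integrable lebesgue {0..t} c"
    and tau_le: "\<And>t. t \<ge> 0 \<Longrightarrow> \<tau> t \<le> t"
    and tau_lim: "filterlim \<tau> at_top at_top"
    and a_nonneg: "a \<ge> 0"
    and rho: "\<rho> > Inf {t. t > 0 \<and> tau_min \<tau> t > ereal a}"
    and c_nonneg: "\<And>t. t \<ge> 0 \<Longrightarrow> c t \<ge> 0"
    and sup_le: "sup_delay_integral c \<tau> \<rho> \<le> ereal K"
    and K: "1 \<le> K" "K \<le> 3 / 2"
    and t0: "\<rho> \<le> t0" and sol: "is_solution c \<tau> t0 x"
    and osc: "oscillatory_on (sol_domain \<tau> t0) x"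
  obtains m where "sol_domain \<tau> t0 = {m..}"
    "oscillatory_solution c \<tau> (\<lambda>t. integral {0..t} c) x m t0 K"
proof -
  have "0 < t0" and tau_min: "ereal a < tau_min \<tau> t0"
    using tau_min_pos_beyond[OF tau_lim rho t0] by auto
  have tau_min_le: "tau_min \<tau> t0 \<le> ereal (\<tau> u)" if "t0 \<le> u" for u
    unfolding tau_min_def by (rule INF_lower) (use that in simp)
  \<comment> \<open>The infimum is above \<open>a\<close> and at most \<open>\<tau> t0\<close>,
    hence finite.\<close>
  obtain m where m: "tau_min \<tau> t0 = ereal m"
    using tau_min tau_min_le[of t0] by (cases "tau_min \<tau> t0") auto
  have dom: "sol_domain \<tau> t0 = {m..}" by (auto simp: sol_domain_def m)
  have "0 \<le> m" using tau_min a_nonneg by (simp add: m)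
  have tau_ge: "m \<le> \<tau> u" if "t0 \<le> u" for u using tau_min_le[OF that] by (simp add: m)
  have "m \<le> t0" using tau_ge[of t0] tau_le[of t0] \<open>0 < t0\<close> by simp
  have abs_int: "set_integrable lebesgue {u..v} c" if "0 \<le> u" "0 \<le> v" for u v
    by (rule set_integrable_subset[OF c_loc_integrable[OF that(2)]]) (use that in auto)
  have int: "c integrable_on {u..v}" if "0 \<le> u" "0 \<le> v" for u v
    using abs_int[OF that] by (rule set_lebesgue_integral_eq_integral(1))
  have C: "(c has_integral integral {0..v} c - integral {0..u} c) {u..v}" if "0 \<le> u" "u \<le> v" for u v
  proof -
    have "integral {0..u} c + integral {u..v} c = integral {0..v} c"
      using that by (intro Henstock_Kurzweil_Integration.integral_combine int) auto
    then have "integral {0..v} c - integral {0..u} c = integral {u..v} c" by simp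
    then show ?thesis using int[of u v] that by (simp add: integrable_integral)
  qed
  have "oscillatory_solution c \<tau> (\<lambda>t. integral {0..t} c) x m t0 K"
  proof
    show "continuous_on {t0..} (\<lambda>t. integral {0..t} c)"
    proof (rule continuous_on_subset)
      show "continuous_on {0..} (\<lambda>t. integral {0..t} c)"
        unfolding continuous_on_eq_continuous_within
      proof
        fix t :: real assume t: "t \<in> {0..}"
        have "continuous_on {0..t + 1} (\<lambda>t. integral {0..t} c)"
          using t by (intro indefinite_integral_continuous_1 int) auto
        then have "continuous (at t within {0..t + 1}) (\<lambda>t. integral {0..t} c)"
          using t by (auto simp: continuous_on_eq_continuous_within)
        \<comment> \<open>The extra 1 keeps \<open>t\<close> away from the right end, so that
          continuity on compact intervals carries over to the half-line.\<close>
        moreover have "at t within {0..t + 1} = at t within {0..}"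
          by (rule at_within_nhd[of _ "{..<t + 1}"]) auto
        ultimately show "continuous (at t within {0..}) (\<lambda>t. integral {0..t} c)" by simp
      qed
    qed (use \<open>0 < t0\<close> in auto)
    show "continuous_on {m..} x"
      unfolding continuous_on_eq_continuous_within
    proof
      fix t :: real assume t: "t \<in> {m..}"
      have "continuous_on {m..t + 1} x"
        using sol t by (intro abs_cont_interval_imp_continuous_on)
          (auto simp: is_solution_def loc_abs_cont_on_def dom)
      then have "continuous (at t within {m..t + 1}) x"
        using t by (auto simp: continuous_on_eq_continuous_within)
      moreover have "at t within {m..t + 1} = at t within {m..}"
        by (rule at_within_nhd[of _ "{..<t + 1}"]) auto
      ultimately show "continuous (at t within {m..}) x" by simp
    qed
    fix u assume u: "t0 \<le> u"
    then have "0 \<le> u" "0 \<le> \<tau> u" "\<tau> u \<le> u" using \<open>0 < t0\<close> tau_ge[of u] tau_le[of u] \<open>0 \<le> m\<close> by auto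
    have "integral {0..u} c - integral {0..\<tau> u} c = integral {\<tau> u..u} c"
      using C[OF \<open>0 \<le> \<tau> u\<close> \<open>\<tau> u \<le> u\<close>] by (simp add: has_integral_iff)
    also have "\<dots> = (LINT \<zeta>:{\<tau> u..u}|lebesgue. c \<zeta>)"
      using abs_int[OF \<open>0 \<le> \<tau> u\<close> \<open>0 \<le> u\<close>] by (rule set_lebesgue_integral_eq_integral(2)[symmetric])
    also have "\<dots> = (LINT \<zeta>:{\<tau> u..u}|lebesgue. \<bar>c \<zeta>\<bar>)"
      using c_nonneg \<open>0 \<le> \<tau> u\<close> by (intro set_lebesgue_integral_cong) auto
    also have "ereal \<dots> \<le> sup_delay_integral c \<tau> \<rho>"
      unfolding sup_delay_integral_def by (rule SUP_upper) (use t0 u in auto)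
    then have "(LINT \<zeta>:{\<tau> u..u}|lebesgue. \<bar>c \<zeta>\<bar>) \<le> K" using sup_le order.trans by fastforce
    finally show "m \<le> \<tau> u \<and> \<tau> u \<le> u \<and> integral {0..u} c - integral {0..\<tau> u} c \<le> K"
      using tau_ge[OF u] \<open>\<tau> u \<le> u\<close> by simp
  next
    show "\<exists>t\<ge>T. x t = 0" for T using osc by (auto simp: oscillatory_on_def)
  qed (use \<open>m \<le> t0\<close> \<open>0 < t0\<close> c_nonneg C is_solution_has_integral[OF sol dom \<open>m \<le> t0\<close>] tau_lim K in auto)
  with dom show thesis by (rule that)
qed

theorem theorem2p1:
  fixes c \<tau> :: "real \<Rightarrow> real" and a \<rho> :: real
  assumes c_measurable: "c \<in> borel_measurable (lebesgue_on {0..})"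
    and c_loc_integrable: "\<And>t. t \<ge> 0 \<Longrightarrow> set_integrable lebesgue {0..t} c"
    and tau_measurable: "\<tau> \<in> borel_measurable (lebesgue_on {0..})"
    and tau_le: "\<And>t. t \<ge> 0 \<Longrightarrow> \<tau> t \<le> t"
    and tau_lim: "filterlim \<tau> at_top at_top"
    and a_nonneg: "a \<ge> 0"
    and a_pos: "tau_min \<tau> a > 0"
    and rho: "\<rho> > Inf {t. t > 0 \<and> tau_min \<tau> t > ereal a}"
    and c_nonneg: "\<And>t. t \<ge> 0 \<Longrightarrow> c t \<ge> 0"
    and sup_le: "sup_delay_integral c \<tau> \<rho> \<le> ereal (3 / 2)"
  shows "(\<forall>t0 x. t0 \<ge> \<rho> \<and> is_solution c \<tau> t0 x \<and> oscillatory_on (sol_domain \<tau> t0) x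
            \<longrightarrow> bounded (x ` sol_domain \<tau> t0)) \<and>
         (sup_delay_integral c \<tau> \<rho> < ereal (3 / 2) \<longrightarrow>
            (\<forall>t0 x. t0 \<ge> \<rho> \<and> is_solution c \<tau> t0 x \<and> oscillatory_on (sol_domain \<tau> t0) x
               \<longrightarrow> (x \<longlongrightarrow> 0) at_top))"
proof (intro conjI impI allI; elim conjE)
  fix t0 x
  assume sol: "t0 \<ge> \<rho>" "is_solution c \<tau> t0 x" "oscillatory_on (sol_domain \<tau> t0) x"
  obtain m where "sol_domain \<tau> t0 = {m..}"
    "oscillatory_solution c \<tau> (\<lambda>t. integral {0..t} c) x m t0 (3 / 2)"
    using oscillatory_solutionI[OF c_loc_integrable tau_le tau_lim a_nonneg rho c_nonneg sup_le
        _ order_refl sol] by auto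
  then show "bounded (x ` sol_domain \<tau> t0)"
    by (simp add: oscillatory_solution.bounded_solution)
next
  fix t0 x
  assume strict: "sup_delay_integral c \<tau> \<rho> < ereal (3 / 2)"
    and sol: "t0 \<ge> \<rho>" "is_solution c \<tau> t0 x" "oscillatory_on (sol_domain \<tau> t0) x"
  obtain K0 where "sup_delay_integral c \<tau> \<rho> < ereal K0" "K0 < 3 / 2"
    using ereal_dense2[OF strict] by auto
  \<comment> \<open>Raising \<open>K0\<close> to at least 1 meets the lower bound on
    \<open>K\<close> and keeps it below 3/2, so that the contraction factor stays below 1.\<close>
  moreover define K where "K = max 1 K0"
  ultimately have K: "sup_delay_integral c \<tau> \<rho> \<le> ereal K" "1 \<le> K" "K < 3 / 2"
    by (auto simp: max_def intro: order.trans less_imp_le)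
  then obtain m where "oscillatory_solution c \<tau> (\<lambda>t. integral {0..t} c) x m t0 K"
    using oscillatory_solutionI[OF c_loc_integrable tau_le tau_lim a_nonneg rho c_nonneg K(1,2)
        _ sol]
    by (metis less_imp_le)
  then show "(x \<longlongrightarrow> 0) at_top"
    using \<open>K < 3 / 2\<close> by (rule oscillatory_solution.solution_tendsto_zero)
qed

end
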